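(* Consider the Cauchy problem $$\begin{cases}\partial_t u(t,\mathbf{x})-\sum_{i=1}^{\infty}a_i(t,\mathbf{x})\,\partial_{x_i}u(t,\mathbf{x})-b(t,\mathbf{x})\,u(t,\mathbf{x})=0,\\ u(t,\mathbf{x})|_{t=0}=\phi(\mathbf{x}),\end{cases}$$ where $t\in\mathbb{R}$, $\mathbf{x}=(x_i)_{i=1}^{\infty}\in\mathbb{R}^{\infty}$, the unknown $u$ is real-valued, and the real-valued functions $a_i$ ($i\ge1$) and $b$ are analytic near $(0)$. Let $$G(t,\mathbf{x},\mathbf{w})=\sum_{i=1}^{\infty}a_i(t,\mathbf{x})w_i+w_0\,b(t,\mathbf{x}),\qquad \mathbf{w}=(w_j)_{j=0}^{\infty}\in\mathbb{R}^{\infty}.$$ Suppose that the monomial expansion of $G$ near $(0)$ is absolutely convergent at a point near $\infty$ in the topology $\mathcal{T}^{1/2}$ and that $\phi\in\Xi$. Then the solution to the Cauchy problem is locally unique in the class $\Xi$; that is, any two solutions belonging to $\Xi$ coincide in a neighborhood of $(0)$ in the topology $\mathscr{T}_2$.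
   Context: $\mathbb{R}^{\infty}$ is the countable Cartesian product of copies of $\mathbb{R}$, $(0)$ denotes its zero element, and countable products such as $\mathbb{R}\times\mathbb{R}^{\infty}$ or $\mathbb{R}\times\mathbb{R}^{\infty}\times\mathbb{R}^{\infty}$ are identified with $\mathbb{R}^{\infty}$ (so $(0)$ also denotes the origin there). $\mathbb{N}^{(\mathbb{N})}$ is the set of finitely supported sequences of nonnegative integers; for $\mathbf{x}=(x_i)\in\mathbb{R}^{\infty}$ and $\alpha\in\mathbb{N}^{(\mathbb{N})}$ with $\alpha_k=0$ for $k>n$, $\mathbf{x}^{\alpha}=x_1^{\alpha_1}\cdots x_n^{\alpha_n}$. Analyticity: a real-valued function $f$ on $D\subset\mathbb{R}^{\infty}$ is analytic near $\mathbf{x}_0\in D$ if there are real numbers $c_{\alpha}$ ($\alpha\in\mathbb{N}^{(\mathbb{N})}$) such that $\sum_{\alpha}c_{\alpha}\mathbf{x}^{\alpha}$ converges absolutely for some $\mathbf{x}=(x_i)\in\mathbb{R}^{\infty}$ with all $x_i\ne0$, and for each $\mathbf{h}=(h_i)$ with $|h_i|\le|x_i|$ for all $i$ one has $\mathbf{x}_0+\mathbf{h}\in D$ and $f(\mathbf{x}_0+\mathbf{h})=\sum_{\alpha}c_{\alpha}\mathbf{h}^{\alpha}$ (the monomial expansion of $f$ near $\mathbf{x}_0$). For $0<p<\infty$, the monomial expansion $\sum_\alpha c_\alpha\mathbf{h}^\alpha$ of $f$ near $\mathbf{x}_0$ is called absolutely convergent at a point near $\infty$ in the topology $\mathcal{T}^p$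 if there is $\mathbf{x}=(x_i)\in\mathbb{R}^{\infty}$ with all $x_i\ne0$ and $\sum_i\frac{1}{|x_i|^p}<\infty$ such that $f$ is analytic near $\mathbf{x}_0$ with this expansion and $\sum_{\alpha}|c_{\alpha}\mathbf{x}^{\alpha}|<\infty$. $\mathscr{T}_2$ is the topology on $\mathbb{R}^{\infty}$ with base the sets $\mathbf{x}+B_r^2$, where $\mathbf{x}\in\mathbb{R}^{\infty}$, $r>0$ and $B_r^2=\{(y_i)\in\mathbb{R}^{\infty}:(\sum_i y_i^2)^{1/2}<r\}$. A real-valued function $f$ on $U\subset\mathbb{R}^{\infty}$ is Fréchet differentiable with respect to $\ell^2$ in a neighborhood of $\mathbf{x}\in U$ (in $\mathscr{T}_2$) if there is $r\in(0,1)$ with $\mathbf{x}+B_r^2\subset U$ such that $g(\cdot)=f(\mathbf{x}+\cdot)$ is Fréchet differentiable on $B_r^2$, viewed as an open ball of the Hilbert space $\ell^2$. $\Xi$ is the set of real-valued functions, defined locally near $(0)$ in $\mathbb{R}^{\infty}$, which are Fréchet differentiable with respect to $\ell^2$ and whose Fréchet derivatives are locally continuous near $(0)$ in the $\mathscr{T}_2$ topology. Both functions of $\mathbf{x}$ and functions of $(t,\mathbf{x})$ are considered, via the identification of $\mathbb{R}\times\mathbb{R}^{\infty}$ with $\mathbb{R}^{\infty}$. A solution means a function satisfying the equation and the initial condition locally near $(0)$ in the $\mathscr{T}_2$ topology.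
   Formalization: The point x near infinity is also taken as the point witnessing analyticity, so G equals its monomial expansion on the whole polydisc |h_i| ≤ |x_i|; if G equals it only on some smaller polydisc containing no T_2-neighborhood of (0), uniqueness can fail. *)

theory Defs
  imports "HOL-Analysis.Analysis" "HOL-Library.Poly_Mapping" "HOL-Library.Function_Algebras"
begin

text \<open>
  \<open>rinf\<close> is the countable product of copies of the reals; \<open>0\<close> and \<open>+\<close> on it are the pointwise
  ones of \<^theory>\<open>HOL-Library.Function_Algebras\<close>.  A partially defined real-valued function is
  given by its domain \<open>D\<close> together with a total function whose values outside \<open>D\<close> are irrelevant.
\<close>

type_synonym rinf = "nat \<Rightarrow> real"

subsection \<open>Analyticity and monomial expansions\<close>

definition monomial_at :: "rinf \<Rightarrow> (nat \<Rightarrow>\<^sub>0 nat) \<Rightarrow> real" where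
  "monomial_at x \<alpha> = (\<Prod>i\<in>Poly_Mapping.keys \<alpha>. x i ^ Poly_Mapping.lookup \<alpha> i)"

text \<open>The coefficients \<open>c\<close> and the point \<open>x\<close> witness that \<open>f\<close> is analytic near \<open>x0\<close>.\<close>

definition has_monomial_expansion ::
  "rinf set \<Rightarrow> (rinf \<Rightarrow> real) \<Rightarrow> rinf \<Rightarrow> ((nat \<Rightarrow>\<^sub>0 nat) \<Rightarrow> real) \<Rightarrow> rinf \<Rightarrow> bool" where
  "has_monomial_expansion D f x0 c x \<longleftrightarrow>
     (\<forall>i. x i \<noteq> 0) \<and>
     (\<lambda>\<alpha>. \<bar>c \<alpha> * monomial_at x \<alpha>\<bar>) summable_on UNIV \<and>
     (\<forall>h. (\<forall>i. \<bar>h i\<bar> \<le> \<bar>x i\<bar>) \<longrightarrow>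
        x0 + h \<in> D \<and> ((\<lambda>\<alpha>. c \<alpha> * monomial_at h \<alpha>) has_sum (f (x0 + h))) UNIV)"

definition analytic_near :: "rinf set \<Rightarrow> (rinf \<Rightarrow> real) \<Rightarrow> rinf \<Rightarrow> bool" where
  "analytic_near D f x0 \<longleftrightarrow> (\<exists>c x. has_monomial_expansion D f x0 c x)"

text \<open>
  The point \<open>x\<close> near infinity is itself the point of the definition of analyticity, so that \<open>f\<close> is
  represented by its expansion on the whole polydisc \<open>\<bar>h i\<bar> \<le> \<bar>x i\<bar>\<close>.
\<close>

definition abs_convergent_near_infinity :: "real \<Rightarrow> rinf set \<Rightarrow> (rinf \<Rightarrow> real) \<Rightarrow> rinf \<Rightarrow> bool" where
  "abs_convergent_near_infinity p D f x0 \<longleftrightarrow>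
     (\<exists>c x. has_monomial_expansion D f x0 c x \<and> summable (\<lambda>i. 1 / \<bar>x i\<bar> powr p))"

subsection \<open>The topology \<open>\<T>\<^sub>2\<close>\<close>

definition ball2 :: "real \<Rightarrow> rinf set" where
  "ball2 r = {y. summable (\<lambda>i. (y i)\<^sup>2) \<and> sqrt (suminf (\<lambda>i. (y i)\<^sup>2)) < r}"

definition T2 :: "rinf topology" where
  "T2 = topology_generated_by {(+) x ` ball2 r | x r. r > 0}"

subsection \<open>The Hilbert space \<open>\<ell>\<^sup>2\<close>\<close>

lemma summable_mult_of_squares:
  fixes x y :: rinf
  assumes "summable (\<lambda>i. (x i)\<^sup>2)" "summable (\<lambda>i. (y i)\<^sup>2)"
  shows "summable (\<lambda>i. x i * y i)"
proof (rule summable_comparison_test')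
  show "summable (\<lambda>i. (x i)\<^sup>2 + (y i)\<^sup>2)"
    using assms by (rule summable_add)
  show "norm (x i * y i) \<le> (x i)\<^sup>2 + (y i)\<^sup>2" if "i \<ge> 0" for i
  proof -
    have "2 * (\<bar>x i\<bar> * \<bar>y i\<bar>) \<le> (x i)\<^sup>2 + (y i)\<^sup>2"
      using sum_squares_bound[of "\<bar>x i\<bar>" "\<bar>y i\<bar>"] by simp
    moreover have "0 \<le> \<bar>x i\<bar> * \<bar>y i\<bar>" by simp
    ultimately have "\<bar>x i\<bar> * \<bar>y i\<bar> \<le> (x i)\<^sup>2 + (y i)\<^sup>2" by linarith
    then show ?thesis by (simp add: abs_mult)
  qed
qed

lemma summable_square_add:
  fixes x y :: rinf
  assumes "summable (\<lambda>i. (x i)\<^sup>2)" "summable (\<lambda>i. (y i)\<^sup>2)"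
  shows "summable (\<lambda>i. (x i + y i)\<^sup>2)"
proof -
  have "summable (\<lambda>i. ((x i)\<^sup>2 + (y i)\<^sup>2) + 2 * (x i * y i))"
    using assms summable_mult_of_squares[OF assms] by (intro summable_add summable_mult)
  then show ?thesis by (simp add: power2_sum algebra_simps)
qed

lemma summable_square_scale:
  fixes x :: rinf
  assumes "summable (\<lambda>i. (x i)\<^sup>2)"
  shows "summable (\<lambda>i. (c * x i)\<^sup>2)"
  using summable_mult[OF assms, of "c\<^sup>2"] by (simp add: power_mult_distrib)

typedef ell2 = "{x :: rinf. summable (\<lambda>i. (x i)\<^sup>2)}"
  morphisms ell2_nth Abs_ell2
  by (rule exI[of _ "\<lambda>_. 0"]) simp

lemma summable_ell2_nth: "summable (\<lambda>i. (ell2_nth x i)\<^sup>2)"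
  using ell2_nth[of x] by simp

lemma ell2_eqI: "(\<And>i. ell2_nth x i = ell2_nth y i) \<Longrightarrow> x = y"
  by (metis ell2_nth_inject ext)

instantiation ell2 :: real_inner
begin

definition "0 = Abs_ell2 (\<lambda>_. 0)"
definition "x + y = Abs_ell2 (\<lambda>i. ell2_nth x i + ell2_nth y i)"
definition "x - y = Abs_ell2 (\<lambda>i. ell2_nth x i - ell2_nth y i)"
definition "- x = Abs_ell2 (\<lambda>i. - ell2_nth x i)"
definition "c *\<^sub>R x = Abs_ell2 (\<lambda>i. c * ell2_nth x i)"
definition "x \<bullet> y = suminf (\<lambda>i. ell2_nth x i * ell2_nth y i)" for x y :: ell2
definition "norm x = sqrt (x \<bullet> x)" for x :: ell2
definition "dist x y = norm (x - y)" for x y :: ell2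
definition "sgn x = inverse (norm x) *\<^sub>R x" for x :: ell2
definition [code del]:
  "(uniformity :: (ell2 \<times> ell2) filter) = (INF e\<in>{0<..}. principal {(x, y). dist x y < e})"
definition [code del]:
  "open (U :: ell2 set) \<longleftrightarrow> (\<forall>x\<in>U. \<forall>\<^sub>F (x', y) in uniformity. x' = x \<longrightarrow> y \<in> U)"

lemma ell2_nth_zero [simp]: "ell2_nth 0 i = 0"
  by (simp add: zero_ell2_def Abs_ell2_inverse)

lemma ell2_nth_add [simp]: "ell2_nth (x + y) i = ell2_nth x i + ell2_nth y i"
  by (simp add: plus_ell2_def Abs_ell2_inverse summable_square_add summable_ell2_nth)

lemma ell2_nth_uminus [simp]: "ell2_nth (- x) i = - ell2_nth x i"
  by (simp add: uminus_ell2_def Abs_ell2_inverse summable_ell2_nth)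

lemma ell2_nth_diff [simp]: "ell2_nth (x - y) i = ell2_nth x i - ell2_nth y i"
proof -
  have "summable (\<lambda>i. (ell2_nth x i - ell2_nth y i)\<^sup>2)"
    using summable_square_add[OF summable_ell2_nth[of x] summable_ell2_nth[of "- y"]] by simp
  then show ?thesis by (simp add: minus_ell2_def Abs_ell2_inverse)
qed

lemma ell2_nth_scaleR [simp]: "ell2_nth (c *\<^sub>R x) i = c * ell2_nth x i"
  by (simp add: scaleR_ell2_def Abs_ell2_inverse summable_square_scale summable_ell2_nth)

lemma summable_ell2_inner: "summable (\<lambda>i. ell2_nth x i * ell2_nth y i)"
  by (intro summable_mult_of_squares summable_ell2_nth)

instance
proof
  fix x y z :: ell2 and a b :: real
  show "x + y + z = x + (y + z)" "x + y = y + x" "0 + x = x" "- x + x = 0" "x - y = x + - y"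
    "a *\<^sub>R (x + y) = a *\<^sub>R x + a *\<^sub>R y" "(a + b) *\<^sub>R x = a *\<^sub>R x + b *\<^sub>R x"
    "a *\<^sub>R b *\<^sub>R x = (a * b) *\<^sub>R x" "1 *\<^sub>R x = x"
    by (rule ell2_eqI, simp add: algebra_simps)+
  show "dist x y = norm (x - y)" "sgn x = inverse (norm x) *\<^sub>R x" "norm x = sqrt (x \<bullet> x)"
    by (simp_all add: dist_ell2_def sgn_ell2_def norm_ell2_def)
  show "uniformity = (INF e\<in>{0<..}. principal {(x, y :: ell2). dist x y < e})"
    by (rule uniformity_ell2_def)
  show "open U \<longleftrightarrow> (\<forall>x\<in>U. \<forall>\<^sub>F (x', y) in uniformity. x' = x \<longrightarrow> y \<in> U)" for U :: "ell2 set"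
    by (rule open_ell2_def)
  show "x \<bullet> y = y \<bullet> x"
    by (simp add: inner_ell2_def mult.commute)
  show "(x + y) \<bullet> z = x \<bullet> z + y \<bullet> z"
    by (simp add: inner_ell2_def distrib_right suminf_add[OF summable_ell2_inner summable_ell2_inner])
  show "(a *\<^sub>R x) \<bullet> y = a * (x \<bullet> y)"
    by (simp add: inner_ell2_def mult.assoc suminf_mult[OF summable_ell2_inner])
  show "0 \<le> x \<bullet> x"
    by (simp add: inner_ell2_def suminf_nonneg[OF summable_ell2_inner])
  show "x \<bullet> x = 0 \<longleftrightarrow> x = 0"
    using suminf_eq_zero_iff[OF summable_ell2_inner[of x x]]
    by (auto simp: inner_ell2_def intro: ell2_eqI)
qed

end

subsection \<open>Frechet differentiability and the class \<open>\<Xi>\<close>\<close>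

definition has_frechet_derivative_near ::
  "rinf set \<Rightarrow> (rinf \<Rightarrow> real) \<Rightarrow> rinf \<Rightarrow> real \<Rightarrow> (ell2 \<Rightarrow> ell2 \<Rightarrow>\<^sub>L real) \<Rightarrow> bool" where
  "has_frechet_derivative_near U f x r f' \<longleftrightarrow>
     0 < r \<and> r < 1 \<and> (+) x ` ball2 r \<subseteq> U \<and>
     (\<forall>h\<in>ball 0 r. ((\<lambda>h. f (x + ell2_nth h)) has_derivative blinfun_apply (f' h)) (at h))"

text \<open>
  \<open>\<T>\<^sub>2\<close> induces the norm topology on \<open>\<ell>\<^sup>2\<close>, so local continuity of the derivative near \<open>0\<close> is
  continuity on a ball of \<open>\<ell>\<^sup>2\<close>, with the operator norm on the dual.
\<close>

definition Xi :: "(rinf set \<times> (rinf \<Rightarrow> real)) set" where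
  "Xi = {(U, f). \<exists>r f'. has_frechet_derivative_near U f 0 r f' \<and>
                   (\<exists>s. 0 < s \<and> s \<le> r \<and> continuous_on (ball 0 s) f')}"

subsection \<open>The Cauchy problem\<close>

text \<open>
  A pair \<open>(t, x)\<close> is identified with the sequence \<open>z = case_nat t x\<close>, i.e. \<open>z 0 = t\<close> and
  \<open>z (Suc i) = x i\<close>.  The coordinates of \<open>x\<close> and the coefficients \<open>a\<close> are numbered from \<open>0\<close>, so
  \<open>a i\<close> multiplies the derivative with respect to \<open>z (Suc i)\<close>.
\<close>

definition partial_deriv :: "nat \<Rightarrow> (rinf \<Rightarrow> real) \<Rightarrow> rinf \<Rightarrow> real" where
  "partial_deriv j u z = deriv (\<lambda>s. u (z(j := s))) (z j)"

text \<open>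
  The triple \<open>(t, x, w)\<close> is identified with the sequence \<open>v\<close> having \<open>(t, x)\<close> at its even and \<open>w\<close>
  at its odd positions.  The domain of \<open>G\<close> consists of the points where the formula makes sense;
  \<open>A i\<close> and \<open>B\<close> are the domains of \<open>a i\<close> and \<open>b\<close>.
\<close>

definition tx_part :: "rinf \<Rightarrow> rinf" where
  "tx_part v = (\<lambda>n. v (2 * n))"

definition w_part :: "rinf \<Rightarrow> rinf" where
  "w_part v = (\<lambda>n. v (2 * n + 1))"

definition G_fun :: "(nat \<Rightarrow> rinf \<Rightarrow> real) \<Rightarrow> (rinf \<Rightarrow> real) \<Rightarrow> rinf \<Rightarrow> real" where
  "G_fun a b v =
     suminf (\<lambda>i. a i (tx_part v) * w_part v (Suc i)) + w_part v 0 * b (tx_part v)"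

definition G_dom :: "(nat \<Rightarrow> rinf set) \<Rightarrow> rinf set \<Rightarrow> (nat \<Rightarrow> rinf \<Rightarrow> real) \<Rightarrow> rinf set" where
  "G_dom A B a =
     {v. (\<forall>i. tx_part v \<in> A i) \<and> tx_part v \<in> B \<and>
         summable (\<lambda>i. a i (tx_part v) * w_part v (Suc i))}"

definition cauchy_solution ::
  "(nat \<Rightarrow> rinf set) \<Rightarrow> (nat \<Rightarrow> rinf \<Rightarrow> real) \<Rightarrow> rinf set \<Rightarrow> (rinf \<Rightarrow> real) \<Rightarrow>
   rinf set \<Rightarrow> (rinf \<Rightarrow> real) \<Rightarrow> rinf set \<Rightarrow> (rinf \<Rightarrow> real) \<Rightarrow> bool" where
  "cauchy_solution A a B b W \<phi> U u \<longleftrightarrow>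
     (\<exists>N. openin T2 N \<and> 0 \<in> N \<and> N \<subseteq> U \<and> N \<subseteq> B \<and> (\<forall>i. N \<subseteq> A i) \<and>
        (\<forall>z\<in>N. (\<forall>j. (\<lambda>s. u (z(j := s))) differentiable at (z j)) \<and>
               summable (\<lambda>i. a i z * partial_deriv (Suc i) u z) \<and>
               partial_deriv 0 u z - suminf (\<lambda>i. a i z * partial_deriv (Suc i) u z) - b z * u z = 0) \<and>
        (\<forall>x. case_nat 0 x \<in> N \<longrightarrow> x \<in> W \<and> u (case_nat 0 x) = \<phi> x))"

end

theory Submission
  imports Defs
begin

text \<open>
  The equation is linear of first order with a real scalar unknown, so the classical method of
  characteristics applies, provided that the characteristics exist in infinitely many variables.
  The difference \<open>w = u - v\<close> of two solutions satisfies the same equation with initial value 0. Along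
  a curve with velocity \<open>F = (1, - a 0, - a 1, \<dots>)\<close> the equation says that the derivative of \<open>w\<close> is
  \<open>b * w\<close>. Following such a curve from a point near the origin to the hyperplane \<open>t = 0\<close>, where \<open>w\<close>
  vanishes, Gronwall's argument gives \<open>w = 0\<close> at the starting point.

  The analytic hypothesis on \<open>G\<close> is what makes \<open>F\<close> a Lipschitz field with values in \<open>\<ell>\<^sup>2\<close>. If the
  expansion of \<open>G\<close> converges absolutely at \<open>X\<close>, then \<open>G\<close> is bounded on the polydisc of \<open>X\<close>, and on the
  polydisc of half the size it is Lipschitz in the supremum norm, because the sum of \<open>1 / \<bar>X j\<bar>\<close> is
  finite along with that of the square roots. Since \<open>G\<close> is linear in \<open>w\<close>, the coefficient \<open>a i\<close> is
  \<open>G\<close> at a multiple of a unit vector divided by that multiple, which may be of the order of the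
  corresponding entry of \<open>X\<close>. The bounds and Lipschitz constants of the \<open>a i\<close> are therefore of the order of the inverses of these entries, and
  those are square summable (\<open>cauchy_coefficients_bounds\<close>).

  Differentiating \<open>w\<close> along a curve in \<open>\<ell>\<^sup>2\<close> is legitimate by Frechet differentiability, and the
  derivative in the direction \<open>F\<close> is the series in the equation since a continuous functional may be
  evaluated coordinatewise (\<open>cauchy_solution_characteristic_derivative\<close>). As \<open>\<ell>\<^sup>2\<close> is complete, the
  flow lines of \<open>F\<close> exist by the contraction principle (\<open>flow_line_exists\<close>); the
  argument along them is \<open>vanishes_along_characteristics\<close>.
\<close>

section \<open>The Hilbert space of square-summable sequences and the topology of its translates\<close>

lemma norm_ell2_squared: "(norm x)\<^sup>2 = suminf (\<lambda>i. (ell2_nth x i)\<^sup>2)"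
  unfolding power2_norm_eq_inner inner_ell2_def by (simp add: power2_eq_square)

lemma abs_ell2_nth_le_norm: "\<bar>ell2_nth x i\<bar> \<le> norm x"
proof -
  have "sum (\<lambda>j. (ell2_nth x j)\<^sup>2) {i} \<le> suminf (\<lambda>j. (ell2_nth x j)\<^sup>2)"
    by (rule sum_le_suminf) (auto simp: summable_ell2_nth)
  then have "\<bar>ell2_nth x i\<bar>\<^sup>2 \<le> (norm x)\<^sup>2" by (simp add: norm_ell2_squared)
  then show ?thesis by (simp add: power2_le_iff_abs_le)
qed

lemma bounded_linear_ell2_nth: "bounded_linear (\<lambda>x. ell2_nth x i)"
  by (rule bounded_linear_intro[of _ 1]) (auto simp: abs_ell2_nth_le_norm)

lemma ball2_eq_image_ball: "ball2 r = ell2_nth ` ball 0 r"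
proof (intro equalityI subsetI)
  fix y assume "y \<in> ball2 r"
  then have y: "ell2_nth (Abs_ell2 y) = y" "sqrt (suminf (\<lambda>i. (y i)\<^sup>2)) < r"
    by (auto simp: ball2_def Abs_ell2_inverse)
  then have "norm (Abs_ell2 y) < r"
    by (metis norm_ell2_squared norm_ge_zero real_sqrt_unique)
  then show "y \<in> ell2_nth ` ball 0 r" using y(1) by (metis dist_0_norm imageI mem_ball)
next
  fix y assume "y \<in> ell2_nth ` ball 0 r"
  then show "y \<in> ball2 r"
    by (auto simp: ball2_def summable_ell2_nth norm_ell2_squared[symmetric])
qed

lemma norm_ell2_le_majorant:
  assumes "summable (\<lambda>i. (q i)\<^sup>2)" "\<And>i. \<bar>ell2_nth x i\<bar> \<le> c * q i" "0 \<le> c"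
  shows "norm x \<le> c * sqrt (suminf (\<lambda>i. (q i)\<^sup>2))"
proof (rule power2_le_imp_le)
  have "suminf (\<lambda>i. (ell2_nth x i)\<^sup>2) \<le> suminf (\<lambda>i. c\<^sup>2 * (q i)\<^sup>2)"
  proof (rule suminf_le)
    show "(ell2_nth x i)\<^sup>2 \<le> c\<^sup>2 * (q i)\<^sup>2" for i
      using power_mono[OF assms(2)[of i] abs_ge_zero, of 2] by (simp add: power_mult_distrib)
  qed (auto intro: summable_ell2_nth summable_mult assms)
  also have "\<dots> = (c * sqrt (suminf (\<lambda>i. (q i)\<^sup>2)))\<^sup>2"
    by (simp add: suminf_mult assms power_mult_distrib suminf_nonneg)
  finally show "(norm x)\<^sup>2 \<le> (c * sqrt (suminf (\<lambda>i. (q i)\<^sup>2)))\<^sup>2" by (simp add: norm_ell2_squared)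
  show "0 \<le> c * sqrt (suminf (\<lambda>i. (q i)\<^sup>2))" using assms by (simp add: suminf_nonneg)
qed

text \<open>
  Fatou's lemma for counting measure: norm bounds survive coordinatewise limits, because each partial
  sum of squares involves finitely many coordinates. Applied to \<open>X m - X n\<close> as \<open>n\<close> grows, it
  shows that \<open>X m\<close> differs from the coordinatewise limit by a sequence in \<open>\<ell>\<^sup>2\<close> of small norm: the
  limit lies in \<open>\<ell>\<^sup>2\<close> and the convergence is in norm.
\<close>

lemma ell2_coordinatewise_limit:
  assumes conv: "\<And>i. (\<lambda>n. ell2_nth (Y n) i) \<longlonglongrightarrow> l i" and le: "\<And>n. n \<ge> M \<Longrightarrow> norm (Y n) \<le> e" and "0 \<le> e"
  shows "summable (\<lambda>i. (l i)\<^sup>2)" "norm (Abs_ell2 l) \<le> e"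
proof -
  have part: "(\<Sum>i<k. (l i)\<^sup>2) \<le> e\<^sup>2" for k
  proof (rule LIMSEQ_le_const2)
    show "(\<lambda>n. \<Sum>i<k. (ell2_nth (Y n) i)\<^sup>2) \<longlonglongrightarrow> (\<Sum>i<k. (l i)\<^sup>2)"
      by (intro tendsto_sum tendsto_power conv)
    have "(\<Sum>i<k. (ell2_nth (Y n) i)\<^sup>2) \<le> e\<^sup>2" if "n \<ge> M" for n
    proof -
      have "(\<Sum>i<k. (ell2_nth (Y n) i)\<^sup>2) \<le> (norm (Y n))\<^sup>2"
        unfolding norm_ell2_squared by (rule sum_le_suminf) (auto simp: summable_ell2_nth)
      also have "\<dots> \<le> e\<^sup>2" using le[OF that] by (simp add: power_mono)
      finally show ?thesis .
    qed
    then show "\<exists>N. \<forall>n\<ge>N. (\<Sum>i<k. (ell2_nth (Y n) i)\<^sup>2) \<le> e\<^sup>2" by blast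
  qed
  show summ: "summable (\<lambda>i. (l i)\<^sup>2)"
    by (rule summableI_nonneg_bounded[OF _ part]) simp
  have "(norm (Abs_ell2 l))\<^sup>2 \<le> e\<^sup>2"
    using suminf_le_const[OF summ part] summ by (simp add: norm_ell2_squared Abs_ell2_inverse)
  then show "norm (Abs_ell2 l) \<le> e" using \<open>0 \<le> e\<close> by (rule power2_le_imp_le)
qed

instance ell2 :: banach
proof
  fix X :: "nat \<Rightarrow> ell2" assume X: "Cauchy X"
  have "Cauchy (\<lambda>n. ell2_nth (X n) i)" for i
    by (rule bounded_linear.Cauchy[OF bounded_linear_ell2_nth X])
  then have "(\<lambda>n. ell2_nth (X n) i) \<longlonglongrightarrow> lim (\<lambda>n. ell2_nth (X n) i)" for i
    by (simp add: Cauchy_convergent convergent_LIMSEQ_iff[symmetric])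
  then obtain l where l: "\<And>i. (\<lambda>n. ell2_nth (X n) i) \<longlonglongrightarrow> l i"
    by (rule that)
  have close: "summable (\<lambda>i. (ell2_nth (X m) i - l i)\<^sup>2) \<and> norm (Abs_ell2 (\<lambda>i. ell2_nth (X m) i - l i)) \<le> e"
    if "0 \<le> e" "\<And>n. n \<ge> M \<Longrightarrow> norm (X m - X n) \<le> e" for m M e
    using ell2_coordinatewise_limit[of "\<lambda>n. X m - X n" "\<lambda>i. ell2_nth (X m) i - l i" M e] that
    by (simp add: tendsto_diff l)
  obtain M where M: "\<And>n. n \<ge> M \<Longrightarrow> norm (X M - X n) \<le> 1"
    using CauchyD[OF X, of 1] by (meson less_imp_le order_refl zero_less_one)
  have "summable (\<lambda>i. (l i)\<^sup>2)"
    using summable_square_add[OF summable_ell2_nth[of "X M"] summable_square_scale[of _ "-1"], of "\<lambda>i. ell2_nth (X M) i - l i"]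
      close[OF _ M] by simp
  then have L: "ell2_nth (Abs_ell2 l) = l" by (simp add: Abs_ell2_inverse)
  have diff: "Abs_ell2 (\<lambda>i. ell2_nth (X m) i - l i) = X m - Abs_ell2 l" for m
    by (simp add: minus_ell2_def L)
  have "X \<longlonglongrightarrow> Abs_ell2 l"
  proof (rule LIMSEQ_I)
    fix r :: real assume "0 < r"
    then obtain M where "\<And>m n. m \<ge> M \<Longrightarrow> n \<ge> M \<Longrightarrow> norm (X m - X n) < r / 2"
      using CauchyD[OF X, of "r/2"] by (meson half_gt_zero)
    then have "norm (X m - Abs_ell2 l) \<le> r / 2" if "m \<ge> M" for m
      using close[of "r/2" M m] \<open>0 < r\<close> that by (simp add: diff less_imp_le)
    then show "\<exists>N. \<forall>n\<ge>N. norm (X n - Abs_ell2 l) < r"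
      using \<open>0 < r\<close> by (smt (verit) field_sum_of_halves)
  qed
  then show "convergent X" by (auto simp: convergent_def)
qed

definition ell2_unit :: "nat \<Rightarrow> ell2" where
  "ell2_unit j = Abs_ell2 (\<lambda>i. if i = j then 1 else 0)"

lemma ell2_nth_unit [simp]: "ell2_nth (ell2_unit j) i = (if i = j then 1 else 0)"
proof -
  have "summable (\<lambda>i. (if i = j then 1 else 0 :: real)\<^sup>2)"
    by (rule summable_finite[of "{j}"]) auto
  then show ?thesis by (simp add: ell2_unit_def Abs_ell2_inverse)
qed

lemma ell2_nth_sum: "ell2_nth (sum f S) i = (\<Sum>j\<in>S. ell2_nth (f j) i)"
  by (induction S rule: infinite_finite_induct) auto

lemma ell2_unit_expansion: "(\<lambda>i. ell2_nth y i *\<^sub>R ell2_unit i) sums y"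
proof -
  let ?p = "\<lambda>n. \<Sum>i<n. ell2_nth y i *\<^sub>R ell2_unit i"
  have sq: "(norm (?p n - y))\<^sup>2 = suminf (\<lambda>i. (ell2_nth y i)\<^sup>2) - (\<Sum>i<n. (ell2_nth y i)\<^sup>2)" for n
  proof -
    have "(\<lambda>i. (ell2_nth (?p n - y) i)\<^sup>2) = (\<lambda>i. (ell2_nth y i)\<^sup>2 - (if i \<in> {..<n} then (ell2_nth y i)\<^sup>2 else 0))"
      by (auto simp: ell2_nth_sum if_distrib sum.delta cong: if_cong)
    moreover have "(\<lambda>i. if i \<in> {..<n} then (ell2_nth y i)\<^sup>2 else 0) sums (\<Sum>i<n. (ell2_nth y i)\<^sup>2)"
      by (rule sums_If_finite_set) simp
    ultimately have "(\<lambda>i. (ell2_nth (?p n - y) i)\<^sup>2) sums ((suminf (\<lambda>i. (ell2_nth y i)\<^sup>2)) - (\<Sum>i<n. (ell2_nth y i)\<^sup>2))"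
      using sums_diff[OF summable_sums[OF summable_ell2_nth[of y]]] by simp
    then show ?thesis unfolding norm_ell2_squared by (rule sums_unique[symmetric])
  qed
  have "(\<lambda>n. (norm (?p n - y))\<^sup>2) \<longlonglongrightarrow> 0"
    unfolding sq using tendsto_diff[OF tendsto_const[of "suminf (\<lambda>i. (ell2_nth y i)\<^sup>2)"] summable_LIMSEQ[OF summable_ell2_nth[of y]]] by simp
  then have "(\<lambda>n. norm (?p n - y)) \<longlonglongrightarrow> 0"
    by (drule_tac tendsto_real_sqrt) simp
  then show ?thesis
    unfolding sums_def by (rule LIM_zero_cancel[OF tendsto_norm_zero_cancel])
qed

text \<open>
  Links the equation, which speaks of partial derivatives, to the chain rule, which speaks of the
  Frechet derivative: a continuous functional on \<open>\<ell>\<^sup>2\<close> can be evaluated term by term along the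
  expansion in unit vectors, and its value at a unit vector is the partial derivative.
\<close>

lemma has_derivative_as_coordinate_series:
  assumes "((\<lambda>h. f (ell2_nth h)) has_derivative blinfun_apply D) (at h)"
  shows "(\<lambda>i. ell2_nth y i * partial_deriv i f (ell2_nth h)) sums (blinfun_apply D y)"
proof -
  have "partial_deriv i f (ell2_nth h) = blinfun_apply D (ell2_unit i)" for i
  proof -
    let ?l = "\<lambda>s. h + (s - ell2_nth h i) *\<^sub>R ell2_unit i"
    have eq: "(ell2_nth h)(i := s) = ell2_nth (?l s)" for s by auto
    have "(?l has_derivative (\<lambda>s. s *\<^sub>R ell2_unit i)) (at (ell2_nth h i))"
      by (auto intro!: derivative_eq_intros)
    then have "((\<lambda>s. f (ell2_nth (?l s))) has_derivative (\<lambda>s. blinfun_apply D (s *\<^sub>R ell2_unit i))) (at (ell2_nth h i))"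
      by (rule has_derivative_compose[where g = "\<lambda>h. f (ell2_nth h)" and f = ?l]) (use assms in simp)
    then have "((\<lambda>s. f (ell2_nth (?l s))) has_real_derivative blinfun_apply D (ell2_unit i)) (at (ell2_nth h i))"
      by (simp add: has_field_derivative_def blinfun.scaleR_right mult_commute_abs)
    then show ?thesis unfolding partial_deriv_def eq by (rule DERIV_imp_deriv)
  qed
  then show ?thesis
    using bounded_linear.sums[OF blinfun.bounded_linear_right ell2_unit_expansion, of D y]
    by (simp add: blinfun.scaleR_right)
qed

text \<open>
  The translated balls are given as a subbase of the topology, so the claim is proved by induction on
  the generation of open sets; it then has to be stated for all points of \<open>\<ell>\<^sup>2\<close> and not just 0.
\<close>

lemma openin_T2_contains_ball:
  assumes "openin T2 N" "0 \<in> N"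
  obtains r where "r > 0" "ball2 r \<subseteq> N"
proof -
  have near: "\<exists>r>0. ell2_nth h \<in> S \<longrightarrow> (\<forall>y\<in>ball h r. ell2_nth y \<in> S)" if "generate_topology_on {(+) x ` ball2 r | x r. r > 0} S" for S h
    using that
  proof (induction arbitrary: h)
    case (Int a b)
    from Int.IH(1)[of h] Int.IH(2)[of h] obtain r s where
      "r > 0" "ell2_nth h \<in> a \<longrightarrow> (\<forall>y\<in>ball h r. ell2_nth y \<in> a)"
      "s > 0" "ell2_nth h \<in> b \<longrightarrow> (\<forall>y\<in>ball h s. ell2_nth y \<in> b)" by blast
    then show ?case by (intro exI[of _ "min r s"]) auto
  next
    case (UN K)
    then show ?case by (metis UnionE UnionI zero_less_one)
  next
    case (Basis S)
    then obtain x r where S: "S = (+) x ` ball2 r" by blast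
    show ?case
    proof (cases "ell2_nth h \<in> S")
      case True
      then obtain k where k: "k \<in> ball 0 r" "ell2_nth h = x + ell2_nth k" by (auto simp: S ball2_eq_image_ball)
      have "ell2_nth y \<in> S" if "y \<in> ball h (r - norm k)" for y
      proof -
        have "ell2_nth y = x + ell2_nth (k + (y - h))" using k(2) by (auto simp: fun_eq_iff)
        moreover have "norm (k + (y - h)) < r"
          using that norm_triangle_ineq[of k "y - h"] by (simp add: dist_norm norm_minus_commute)
        ultimately show ?thesis unfolding S ball2_eq_image_ball by (intro image_eqI[of _ _ "ell2_nth (k + (y - h))"]) auto
      qed
      then show ?thesis using k(1) by (intro exI[of _ "r - norm k"]) auto
    qed (auto intro: exI[of _ 1])
  qed (auto intro: exI[of _ 1])
  have "ell2_nth 0 = 0" by (simp add: fun_eq_iff)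
  then have "ell2_nth 0 \<in> N" using assms(2) by simp
  moreover have "generate_topology_on {(+) x ` ball2 r | x r. r > 0} N"
    using assms(1) unfolding T2_def openin_topology_generated_by_iff .
  ultimately obtain r where "r > 0" "\<forall>y\<in>ball 0 r. ell2_nth y \<in> N"
    using near[of N 0] by blast
  then show ?thesis by (intro that) (auto simp: ball2_eq_image_ball)
qed

section \<open>Flow lines of Lipschitz vector fields\<close>

text \<open>
  Picard-Lindelof, normalised to the time interval \<open>{0..1}\<close>: a field of Lipschitz constant below 1
  makes the integral operator a contraction, and a field bounded by \<open>R / 2\<close> cannot push a point of
  the half ball out of the ball within unit time. Longer or shorter times are reached by rescaling
  the field.
\<close>

lemma flow_line_exists:
  fixes F :: "'a::banach \<Rightarrow> 'a"
  assumes L: "0 \<le> L" "L < 1"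
    and lip: "\<And>x y. x \<in> cball 0 R \<Longrightarrow> y \<in> cball 0 R \<Longrightarrow> norm (F x - F y) \<le> L * norm (x - y)"
    and bound: "\<And>x. x \<in> cball 0 R \<Longrightarrow> norm (F x) \<le> R / 2"
    and z0: "norm z0 \<le> R / 2"
  obtains z where "continuous_on {0..1::real} z" "z 0 = z0" "\<forall>t. z t \<in> cball 0 R"
    "\<forall>t\<in>{0<..<1}. (z has_vector_derivative F (z t)) (at t)"
proof -
  \<comment> \<open>Clamping time to \<open>{0..1}\<close> lets the fixed point be sought among bounded functions on the whole line.\<close>
  define p where "p t = max 0 (min 1 t)" for t :: real
  define P where "P f t = z0 + integral {0..p t} (\<lambda>s. F (f s))" for f :: "real \<Rightarrow> 'a" and t
  define S where "S = (PiC UNIV (\<lambda>_. cball 0 R) :: (real \<Rightarrow>\<^sub>C 'a) set)"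
  have S: "f \<in> S \<longleftrightarrow> (\<forall>t. apply_bcontfun f t \<in> cball 0 R)" for f
    by (auto simp: S_def mem_PiC_iff)
  have p: "p t \<in> {0..1}" for t by (auto simp: p_def)
  have R: "0 \<le> R" using z0 norm_ge_zero[of z0] by linarith
  have contF: "continuous_on (cball 0 R) F"
    using lipschitz_on_continuous_on[of L "cball 0 R" F] lip L(1)
    by (auto simp: lipschitz_on_def dist_norm)
  have cont: "continuous_on T (\<lambda>s. F (apply_bcontfun f s))" if "f \<in> S" for f T
    by (rule continuous_on_compose2[OF contF continuous_on_apply_bcontfun]) (use that S in auto)
  have intgr: "(\<lambda>s. F (apply_bcontfun f s)) integrable_on {a..b}" if "f \<in> S" for f a b
    by (intro integrable_continuous_real cont that)
  have P_ball: "P f t \<in> cball 0 R" if "f \<in> S" for f t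
  proof -
    have "norm (integral {0..p t} (\<lambda>s. F (apply_bcontfun f s))) \<le> R / 2 * (p t - 0)"
      by (rule integral_bound) (use p that S cont bound in auto)
    also have "\<dots> \<le> R / 2" using p[of t] R by (simp add: mult_left_le)
    finally show ?thesis
      using z0 norm_triangle_ineq[of z0 "integral {0..p t} (\<lambda>s. F (apply_bcontfun f s))"]
      by (simp add: P_def)
  qed
  have P_cont: "continuous_on UNIV (P f)" if "f \<in> S" for f
  proof -
    have "continuous_on {0..1} (\<lambda>u. integral {0..u} (\<lambda>s. F (apply_bcontfun f s)))"
      by (rule indefinite_integral_continuous_1[OF intgr[OF that]])
    then show ?thesis unfolding P_def
      by (intro continuous_intros continuous_on_compose2[of "{0..1}" "\<lambda>u. integral {0..u} (\<lambda>s. F (apply_bcontfun f s))" UNIV p])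
        (use p in \<open>auto simp: p_def intro!: continuous_intros\<close>)
  qed
  have P_apply: "apply_bcontfun (Bcontfun (P f)) = P f" if "f \<in> S" for f
  proof (rule Bcontfun_inverse)
    show "P f \<in> bcontfun" using P_cont[OF that] P_ball[OF that]
      by (intro bcontfun_normI[where b = R]) auto
  qed
  have "\<exists>!f\<in>S. Bcontfun (P (apply_bcontfun f)) = f"
  proof (rule Banach_fix[OF _ _ L])
    show "complete S" unfolding S_def complete_eq_closed by (intro closed_PiC) simp
    show "S \<noteq> {}"
    proof -
      have "const_bcontfun z0 \<in> S" using z0 R by (auto simp: S)
      then show ?thesis by blast
    qed
    show "(\<lambda>f. Bcontfun (P (apply_bcontfun f))) ` S \<subseteq> S" using P_ball by (auto simp: S P_apply)
    fix f g assume fg: "f \<in> S" "g \<in> S"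
    show "dist (Bcontfun (P f)) (Bcontfun (P g)) \<le> L * dist f g"
    proof (rule dist_bound)
      fix t
      let ?fg = "\<lambda>s. F (apply_bcontfun f s) - F (apply_bcontfun g s)"
      have "P f t - P g t = integral {0..p t} ?fg"
        unfolding P_def by (simp add: integral_diff intgr fg)
      moreover have "norm (integral {0..p t} ?fg) \<le> (L * dist f g) * (p t - 0)"
      proof (rule integral_bound)
        fix s
        have "norm (?fg s) \<le> L * dist (f s) (g s)"
          using lip[of "f s" "g s"] fg S by (simp add: dist_norm)
        also have "\<dots> \<le> L * dist f g" using L by (intro mult_left_mono dist_bounded) auto
        finally show "norm (?fg s) \<le> L * dist f g" .
      qed (use p fg in \<open>auto intro!: continuous_intros cont\<close>)
      moreover have "(L * dist f g) * (p t - 0) \<le> L * dist f g"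
        using p[of t] L by (simp add: mult_left_le)
      ultimately show "dist (apply_bcontfun (Bcontfun (P f)) t) (apply_bcontfun (Bcontfun (P g)) t) \<le> L * dist f g"
        by (simp add: P_apply fg dist_norm)
    qed
  qed
  then obtain f where f: "f \<in> S" "Bcontfun (P (apply_bcontfun f)) = f" by blast
  then have fixpt: "apply_bcontfun f = P f" using P_apply by metis
  show thesis
  proof (rule that[of "apply_bcontfun f"])
    show "f 0 = z0" by (subst fixpt) (simp add: P_def p_def)
    show "\<forall>t. f t \<in> cball 0 R" using f(1) S by blast
    show "\<forall>t\<in>{0<..<1}. (f has_vector_derivative F (f t)) (at t)"
    proof
      fix t :: real assume t: "t \<in> {0<..<1}"
      have "((\<lambda>u. integral {0..u} (\<lambda>s. F (f s))) has_vector_derivative F (f t)) (at t within {0..1})"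
        by (rule integral_has_vector_derivative) (use t cont f in auto)
      then have "((\<lambda>u. z0 + integral {0..u} (\<lambda>s. F (f s))) has_vector_derivative F (f t)) (at t)"
        using t by (simp add: at_within_Icc_at has_vector_derivative_add_const add.commute[of z0])
      then show "(f has_vector_derivative F (f t)) (at t)"
      proof (rule has_vector_derivative_transform_within_open[of _ _ _ "{0<..<1}"])
        fix s :: real assume "s \<in> {0<..<1}"
        then show "z0 + integral {0..s} (\<lambda>s. F (f s)) = f s" by (subst (2) fixpt) (simp add: P_def p_def)
      qed (use t in auto)
    qed
  qed simp
qed

text \<open>
  The weight \<open>exp (2 * K * t)\<close> outgrows any decay of \<open>g\<^sup>2\<close>, so the weighted square is nondecreasing; it
  is nonnegative and vanishes at time 1, hence also at time 0.
\<close>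

lemma linear_ode_backward_uniqueness:
  fixes g :: "real \<Rightarrow> real"
  assumes "continuous_on {0..1} g" "g 1 = 0"
    and deriv: "\<And>t. 0 < t \<Longrightarrow> t < 1 \<Longrightarrow> (g has_real_derivative \<beta> t * g t) (at t)"
    and bound: "\<And>t. 0 < t \<Longrightarrow> t < 1 \<Longrightarrow> \<bar>\<beta> t\<bar> \<le> K"
  shows "g 0 = 0"
proof -
  let ?E = "\<lambda>t. (g t)\<^sup>2 * exp (2 * K * t)"
  have "?E 0 \<le> ?E 1"
  proof (rule DERIV_nonneg_imp_increasing_open[where f = ?E])
    show "continuous_on {0..1} ?E" by (intro continuous_intros assms)
    fix t :: real assume t: "0 < t" "t < 1"
    have "(?E has_real_derivative 2 * (\<beta> t + K) * (g t)\<^sup>2 * exp (2 * K * t)) (at t)"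
      by (auto intro!: derivative_eq_intros deriv[OF t] simp: algebra_simps power2_eq_square)
    moreover have "0 \<le> 2 * (\<beta> t + K) * (g t)\<^sup>2 * exp (2 * K * t)" using bound[OF t] by simp
    ultimately show "\<exists>y. (?E has_real_derivative y) (at t) \<and> 0 \<le> y" by blast
  qed simp
  then show ?thesis using assms(2) by simp
qed

section \<open>Lipschitz bounds from an absolutely convergent monomial expansion\<close>

text \<open>
  The constant has to be independent of the exponent. The mean value bound on the unit interval costs
  a factor \<open>m\<close>; staying in the half interval gains \<open>2 ^ m\<close>, which absorbs it.
\<close>

lemma abs_power_diff_le_twice:
  fixes y y' :: real
  assumes "\<bar>y\<bar> \<le> 1 / 2" "\<bar>y'\<bar> \<le> 1 / 2"
  shows "\<bar>y ^ m - y' ^ m\<bar> \<le> 2 * \<bar>y - y'\<bar>"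
proof -
  have "2 ^ m * \<bar>y ^ m - y' ^ m\<bar> = \<bar>(2 * y) ^ m - (2 * y') ^ m\<bar>"
    by (simp add: power_mult_distrib right_diff_distrib[symmetric] abs_mult)
  also have "\<dots> \<le> real m * \<bar>2 * y - 2 * y'\<bar>"
    using norm_power_diff[of "2 * y" "2 * y'" m] assms by (simp add: abs_mult)
  also have "\<dots> = real m * (2 * \<bar>y - y'\<bar>)"
    by (simp only: right_diff_distrib[symmetric] abs_mult abs_numeral)
  also have "\<dots> \<le> 2 ^ m * (2 * \<bar>y - y'\<bar>)"
    using of_nat_less_two_power[of m, where 'a = real] by (intro mult_right_mono) auto
  finally show ?thesis by simp
qed

lemma abs_monomial_at_mono:
  assumes "\<And>j. \<bar>h j\<bar> \<le> \<bar>X j\<bar>"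
  shows "\<bar>monomial_at h \<alpha>\<bar> \<le> \<bar>monomial_at X \<alpha>\<bar>"
  unfolding monomial_at_def abs_prod power_abs by (intro prod_mono) (auto intro!: power_mono assms)

text \<open>
  After dividing by \<open>X\<close> all bases lie in the half interval, so the difference of the two products is
  at most the sum of the differences of their factors, each bounded independently of its exponent.
  Summability of \<open>1 / \<bar>X j\<bar>\<close> makes the bound independent of which variables occur in \<open>\<alpha>\<close>.
\<close>

lemma abs_monomial_at_diff_le:
  assumes "\<And>j. X j \<noteq> 0" and h: "\<And>j. \<bar>h j\<bar> \<le> \<bar>X j\<bar> / 2" and h': "\<And>j. \<bar>h' j\<bar> \<le> \<bar>X j\<bar> / 2"
    and d: "\<And>j. \<bar>h j - h' j\<bar> \<le> d" and summ: "summable (\<lambda>j. 1 / \<bar>X j\<bar>)"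
  shows "\<bar>monomial_at h \<alpha> - monomial_at h' \<alpha>\<bar> \<le> \<bar>monomial_at X \<alpha>\<bar> * (2 * d * suminf (\<lambda>j. 1 / \<bar>X j\<bar>))"
proof -
  let ?K = "Poly_Mapping.keys \<alpha>" and ?e = "Poly_Mapping.lookup \<alpha>"
  have scale: "monomial_at k \<alpha> = monomial_at X \<alpha> * (\<Prod>j\<in>?K. (k j / X j) ^ ?e j)" for k
    unfolding monomial_at_def prod.distrib[symmetric]
    by (intro prod.cong) (simp_all add: power_divide assms(1))
  have half: "\<bar>k j / X j\<bar> \<le> 1 / 2" if "\<And>j. \<bar>k j\<bar> \<le> \<bar>X j\<bar> / 2" for k j
    using that[of j] assms(1)[of j] by (simp add: abs_divide field_simps)
  have le1: "\<bar>(k j / X j) ^ ?e j\<bar> \<le> 1" if "\<And>j. \<bar>k j\<bar> \<le> \<bar>X j\<bar> / 2" for k j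
    using half[OF that, of j] unfolding power_abs by (intro power_le_one) linarith+
  have "\<bar>(\<Prod>j\<in>?K. (h j / X j) ^ ?e j) - (\<Prod>j\<in>?K. (h' j / X j) ^ ?e j)\<bar>
      \<le> (\<Sum>j\<in>?K. \<bar>(h j / X j) ^ ?e j - (h' j / X j) ^ ?e j\<bar>)"
    using norm_prod_diff[of ?K "\<lambda>j. (h j / X j) ^ ?e j" "\<lambda>j. (h' j / X j) ^ ?e j"] le1[OF h] le1[OF h'] by simp
  also have "\<dots> \<le> (\<Sum>j\<in>?K. 2 * d * (1 / \<bar>X j\<bar>))"
  proof (rule sum_mono)
    fix j
    have "\<bar>(h j / X j) ^ ?e j - (h' j / X j) ^ ?e j\<bar> \<le> 2 * \<bar>h j / X j - h' j / X j\<bar>"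
      by (intro abs_power_diff_le_twice half h h')
    also have "\<dots> = 2 * \<bar>h j - h' j\<bar> * (1 / \<bar>X j\<bar>)"
      by (simp add: diff_divide_distrib[symmetric] abs_divide)
    also have "\<dots> \<le> 2 * d * (1 / \<bar>X j\<bar>)" using d[of j] by (intro mult_right_mono) auto
    finally show "\<bar>(h j / X j) ^ ?e j - (h' j / X j) ^ ?e j\<bar> \<le> 2 * d * (1 / \<bar>X j\<bar>)" .
  qed
  also have "\<dots> \<le> 2 * d * suminf (\<lambda>j. 1 / \<bar>X j\<bar>)"
    unfolding sum_distrib_left[symmetric]
    using d[of 0] by (intro mult_left_mono sum_le_suminf summ) auto
  finally show ?thesis
    unfolding scale[of h] scale[of h'] right_diff_distrib[symmetric] abs_mult by (intro mult_left_mono) auto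
qed

text \<open>
  Summing the bounds for single monomials against \<open>\<bar>c \<alpha> * monomial_at X \<alpha>\<bar>\<close> loses nothing but a
  constant. The Lipschitz estimate is with respect to the supremum norm, which is weaker than the
  norm of \<open>\<ell>\<^sup>2\<close>.
\<close>

lemma monomial_expansion_bounded_lipschitz:
  assumes exp: "has_monomial_expansion D f 0 c X" and summ: "summable (\<lambda>j. 1 / \<bar>X j\<bar>)"
  obtains C where "0 \<le> C" "\<forall>h. (\<forall>j. \<bar>h j\<bar> \<le> \<bar>X j\<bar>) \<longrightarrow> \<bar>f h\<bar> \<le> C"
    "\<forall>h h' d. (\<forall>j. \<bar>h j\<bar> \<le> \<bar>X j\<bar> / 2) \<and> (\<forall>j. \<bar>h' j\<bar> \<le> \<bar>X j\<bar> / 2) \<and> (\<forall>j. \<bar>h j - h' j\<bar> \<le> d)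
       \<longrightarrow> \<bar>f h - f h'\<bar> \<le> C * d"
proof -
  let ?M = "infsum (\<lambda>\<alpha>. \<bar>c \<alpha> * monomial_at X \<alpha>\<bar>) UNIV" and ?S = "suminf (\<lambda>j. 1 / \<bar>X j\<bar>)"
  have X: "\<And>j. X j \<noteq> 0" and M: "((\<lambda>\<alpha>. \<bar>c \<alpha> * monomial_at X \<alpha>\<bar>) has_sum ?M) UNIV"
    and f: "\<And>h. (\<And>j. \<bar>h j\<bar> \<le> \<bar>X j\<bar>) \<Longrightarrow> ((\<lambda>\<alpha>. c \<alpha> * monomial_at h \<alpha>) has_sum f h) UNIV"
    using exp by (auto simp: has_monomial_expansion_def)
  have M0: "0 \<le> ?M" by (intro infsum_nonneg) simp
  have S0: "0 \<le> ?S" by (intro suminf_nonneg summ) simp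
  have bd: "\<bar>f h\<bar> \<le> ?M" if "\<And>j. \<bar>h j\<bar> \<le> \<bar>X j\<bar>" for h
    using norm_infsum_le[OF f[OF that] M] abs_monomial_at_mono[OF that] by (simp add: abs_mult mult_left_mono)
  have lip: "\<bar>f h - f h'\<bar> \<le> ?M * (2 * d * ?S)"
    if h: "\<And>j. \<bar>h j\<bar> \<le> \<bar>X j\<bar> / 2" and h': "\<And>j. \<bar>h' j\<bar> \<le> \<bar>X j\<bar> / 2"
      and d: "\<And>j. \<bar>h j - h' j\<bar> \<le> d" for h h' d
  proof -
    have full: "\<bar>h j\<bar> \<le> \<bar>X j\<bar>" "\<bar>h' j\<bar> \<le> \<bar>X j\<bar>" for j using h[of j] h'[of j] by linarith+
    have "((\<lambda>\<alpha>. c \<alpha> * monomial_at h \<alpha> - c \<alpha> * monomial_at h' \<alpha>) has_sum (f h - f h')) UNIV"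
      using has_sum_add[OF f[OF full(1)] has_sum_uminusI[OF f[OF full(2)]]] by simp
    then have "norm (f h - f h') \<le> ?M * (2 * d * ?S)"
    proof (rule norm_infsum_le[OF _ has_sum_cmult_left[OF M]])
      fix \<alpha>
      show "norm (c \<alpha> * monomial_at h \<alpha> - c \<alpha> * monomial_at h' \<alpha>) \<le> \<bar>c \<alpha> * monomial_at X \<alpha>\<bar> * (2 * d * ?S)"
        using mult_left_mono[OF abs_monomial_at_diff_le[OF X h h' d summ, of \<alpha>], of "\<bar>c \<alpha>\<bar>"]
        by (simp add: right_diff_distrib[symmetric] abs_mult mult.assoc)
    qed
    then show ?thesis by simp
  qed
  show thesis
  proof (rule that[of "?M + ?M * 2 * ?S"])
    show "0 \<le> ?M + ?M * 2 * ?S" using M0 S0 by simp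
    have "?M \<le> ?M + ?M * 2 * ?S" using M0 S0 by simp
    then show "\<forall>h. (\<forall>j. \<bar>h j\<bar> \<le> \<bar>X j\<bar>) \<longrightarrow> \<bar>f h\<bar> \<le> ?M + ?M * 2 * ?S"
      using bd order_trans by blast
    show "\<forall>h h' d. (\<forall>j. \<bar>h j\<bar> \<le> \<bar>X j\<bar> / 2) \<and> (\<forall>j. \<bar>h' j\<bar> \<le> \<bar>X j\<bar> / 2) \<and> (\<forall>j. \<bar>h j - h' j\<bar> \<le> d)
      \<longrightarrow> \<bar>f h - f h'\<bar> \<le> (?M + ?M * 2 * ?S) * d"
    proof (intro allI impI, elim conjE)
      fix h h' d
      assume hd: "\<forall>j. \<bar>h j\<bar> \<le> \<bar>X j\<bar> / 2" "\<forall>j. \<bar>h' j\<bar> \<le> \<bar>X j\<bar> / 2" "\<forall>j. \<bar>h j - h' j\<bar> \<le> d"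
      then have "0 \<le> d" using abs_ge_zero order_trans by blast
      then have "0 \<le> ?M * d" using M0 by simp
      moreover have "\<bar>f h - f h'\<bar> \<le> ?M * (2 * d * ?S)" using hd by (intro lip) auto
      ultimately show "\<bar>f h - f h'\<bar> \<le> (?M + ?M * 2 * ?S) * d" by (simp add: algebra_simps)
    qed
  qed
qed

section \<open>The coefficients of the equation near the origin\<close>

text \<open>
  The inverse of \<open>v \<mapsto> (tx_part v, w_part v)\<close>.
\<close>

definition interleave :: "rinf \<Rightarrow> rinf \<Rightarrow> rinf" where
  "interleave z w n = (if even n then z (n div 2) else w (n div 2))"

lemma tx_part_interleave [simp]: "tx_part (interleave z w) = z"
  by (auto simp: tx_part_def interleave_def)

lemma w_part_interleave [simp]: "w_part (interleave z w) = w"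
  by (auto simp: w_part_def interleave_def)

text \<open>
  \<open>G\<close> is linear in \<open>w\<close>, so choosing for \<open>w\<close> a multiple of a unit vector isolates a single coefficient.
\<close>

lemma G_fun_interleave_coefficient:
  "G_fun a b (interleave z ((\<lambda>_. 0)(Suc i := s))) = a i z * s"
  "G_fun a b (interleave z ((\<lambda>_. 0)(0 := s))) = s * b z"
  using suminf_finite[of "{i}" "\<lambda>k. a k z * ((\<lambda>_. 0)(Suc i := s)) (Suc k)"]
  by (simp_all add: G_fun_def)

lemma interleave_in_half_polydisc:
  assumes "\<And>j. \<bar>z j\<bar> \<le> R" "\<And>n. R \<le> \<bar>X n\<bar> / 2"
  shows "\<bar>interleave z ((\<lambda>_. 0)(k := X (2 * k + 1) / 2)) n\<bar> \<le> \<bar>X n\<bar> / 2"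
proof (cases "even n")
  case True
  then show ?thesis using assms(1)[of "n div 2"] assms(2)[of n] by (simp add: interleave_def)
next
  case False
  then show ?thesis by (cases "n div 2 = k") (auto simp: interleave_def elim!: oddE)
qed

lemma summable_inverse_of_summable_inverse_root:
  assumes "summable (\<lambda>i. 1 / \<bar>X i\<bar> powr (1 / 2))" "\<And>i. X i \<noteq> (0::real)"
  shows "summable (\<lambda>i. 1 / \<bar>X i\<bar>)"
proof (rule summable_comparison_test_ev[OF _ assms(1)])
  have "(\<lambda>i. 1 / \<bar>X i\<bar> powr (1 / 2)) \<longlonglongrightarrow> 0" by (rule summable_LIMSEQ_zero[OF assms(1)])
  then have "\<forall>\<^sub>F i in sequentially. 1 / \<bar>X i\<bar> powr (1 / 2) < 1" by (rule order_tendstoD) simp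
  then show "\<forall>\<^sub>F i in sequentially. norm (1 / \<bar>X i\<bar>) \<le> 1 / \<bar>X i\<bar> powr (1 / 2)"
  proof eventually_elim
    case (elim i)
    let ?r = "\<bar>X i\<bar> powr (1 / 2)"
    have "0 < ?r" using assms(2)[of i] by simp
    then have "1 < ?r" using elim by (simp add: field_simps)
    then have "?r * 1 \<le> ?r * ?r" by (intro mult_left_mono) auto
    also have "\<dots> = \<bar>X i\<bar>" by (simp add: powr_add[symmetric] assms(2))
    finally have "?r \<le> \<bar>X i\<bar>" by simp
    then show ?case using \<open>0 < ?r\<close> by (simp add: frac_le)
  qed
qed

lemma summable_inverse_square:
  assumes "summable (\<lambda>i. 1 / \<bar>X i\<bar>)"
  shows "summable (\<lambda>i. (1 / \<bar>X i\<bar> :: real)\<^sup>2)"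
proof (rule summable_comparison_test_ev[OF _ assms])
  have "\<forall>\<^sub>F i in sequentially. 1 / \<bar>X i\<bar> < 1"
    by (rule order_tendstoD[OF summable_LIMSEQ_zero[OF assms]]) simp
  then show "\<forall>\<^sub>F i in sequentially. norm ((1 / \<bar>X i\<bar>)\<^sup>2) \<le> 1 / \<bar>X i\<bar>"
    by eventually_elim (simp add: power2_eq_square mult_left_le del: times_divide_eq_left times_divide_eq_right)
qed

text \<open>
  All coefficients are controlled simultaneously because they are values of the one function \<open>G\<close>. To
  isolate \<open>a i\<close> one may choose \<open>w\<close> as large as \<open>\<bar>X (2 * i + 3)\<bar> / 2\<close> without leaving the half polydisc;
  dividing by it turns the bounds for \<open>G\<close> into bounds for \<open>a i\<close> that are square summable in \<open>i\<close>. This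
  is where convergence at a point near infinity enters.
\<close>

lemma cauchy_coefficients_bounds:
  assumes "abs_convergent_near_infinity (1 / 2) (G_dom A B a) (G_fun a b) 0"
  obtains R K q where "0 < R" "summable (\<lambda>i. (q i)\<^sup>2)"
    "\<forall>z i. (\<forall>j. \<bar>z j\<bar> \<le> R) \<longrightarrow> \<bar>a i z\<bar> \<le> q i"
    "\<forall>z. (\<forall>j. \<bar>z j\<bar> \<le> R) \<longrightarrow> \<bar>b z\<bar> \<le> K"
    "\<forall>z z' d i. (\<forall>j. \<bar>z j\<bar> \<le> R) \<and> (\<forall>j. \<bar>z' j\<bar> \<le> R) \<and> (\<forall>j. \<bar>z j - z' j\<bar> \<le> d) \<longrightarrow>
       \<bar>a i z - a i z'\<bar> \<le> d * q i"
proof -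
  obtain c X where exp: "has_monomial_expansion (G_dom A B a) (G_fun a b) 0 c X"
    and root: "summable (\<lambda>i. 1 / \<bar>X i\<bar> powr (1 / 2))"
    using assms unfolding abs_convergent_near_infinity_def by blast
  have X: "X i \<noteq> 0" for i using exp by (simp add: has_monomial_expansion_def)
  have summ: "summable (\<lambda>i. 1 / \<bar>X i\<bar>)"
    by (rule summable_inverse_of_summable_inverse_root[OF root X])
  obtain C where C: "0 \<le> C" "\<forall>h. (\<forall>j. \<bar>h j\<bar> \<le> \<bar>X j\<bar>) \<longrightarrow> \<bar>G_fun a b h\<bar> \<le> C"
    "\<forall>h h' d. (\<forall>j. \<bar>h j\<bar> \<le> \<bar>X j\<bar> / 2) \<and> (\<forall>j. \<bar>h' j\<bar> \<le> \<bar>X j\<bar> / 2) \<and> (\<forall>j. \<bar>h j - h' j\<bar> \<le> d)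
       \<longrightarrow> \<bar>G_fun a b h - G_fun a b h'\<bar> \<le> C * d"
    using monomial_expansion_bounded_lipschitz[OF exp summ] by blast
  define T where "T = suminf (\<lambda>i. 1 / \<bar>X i\<bar>)"
  \<comment> \<open>Every \<open>\<bar>X n\<bar>\<close> is at least \<open>1 / T\<close>, so sequences bounded by \<open>R\<close> lie in the half polydisc.\<close>
  define R where "R = 1 / (2 * T)"
  \<comment> \<open>The slot of \<open>w k\<close> is \<open>2 * k + 1\<close>; it is filled with the largest value allowed in the half polydisc.\<close>
  define e where "e z k = interleave z ((\<lambda>_. 0)(k := X (2 * k + 1) / 2))" for z k
  define q where "q i = 2 * C / \<bar>X (2 * i + 3)\<bar>" for i
  have T: "1 / \<bar>X n\<bar> \<le> T" for n
    using sum_le_suminf[OF summ, of "{n}"] by (simp add: T_def)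
  have "0 < T" using T[of 0] X[of 0] by (smt (verit) divide_pos_pos zero_less_abs_iff)
  then have R: "0 < R" "R \<le> \<bar>X n\<bar> / 2" for n
    using T[of n] X[of n] by (auto simp: R_def field_simps)
  have half: "\<bar>e z k n\<bar> \<le> \<bar>X n\<bar> / 2" if "\<forall>j. \<bar>z j\<bar> \<le> R" for z k n
    unfolding e_def by (rule interleave_in_half_polydisc[OF _ R(2)]) (use that in blast)
  have bd: "\<bar>G_fun a b (e z k)\<bar> \<le> C" if "\<forall>j. \<bar>z j\<bar> \<le> R" for z k
  proof (rule C(2)[rule_format])
    fix j
    show "\<bar>e z k j\<bar> \<le> \<bar>X j\<bar>" using half[of z k j, OF that] by linarith
  qed
  have e_Suc: "G_fun a b (e z (Suc i)) = a i z * (X (2 * i + 3) / 2)" for z i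
    unfolding e_def G_fun_interleave_coefficient by (simp add: eval_nat_numeral)
  have e_0: "G_fun a b (e z 0) = X 1 / 2 * b z" for z
    unfolding e_def G_fun_interleave_coefficient by simp
  show thesis
  proof (rule that[OF R(1)])
    have "summable (\<lambda>i. (1 / \<bar>X i\<bar>)\<^sup>2)" by (rule summable_inverse_square[OF summ])
    then have "summable (\<lambda>i. (1 / \<bar>X (2 * i + 3)\<bar>)\<^sup>2)"
      using summable_reindex[where g = "\<lambda>i. 2 * i + 3" and f = "\<lambda>i. (1 / \<bar>X i\<bar>)\<^sup>2"] by (simp add: inj_def o_def)
    then have "summable (\<lambda>i. (2 * C)\<^sup>2 * (1 / \<bar>X (2 * i + 3)\<bar>)\<^sup>2)" by (rule summable_mult)
    then show "summable (\<lambda>i. (q i)\<^sup>2)" by (simp add: q_def power_divide)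
    have "\<bar>a i z\<bar> \<le> q i" if "\<forall>j. \<bar>z j\<bar> \<le> R" for z i
      using bd[of z "Suc i", OF that] X[of "2 * i + 3"] by (simp add: e_Suc q_def abs_mult abs_divide field_simps)
    then show "\<forall>z i. (\<forall>j. \<bar>z j\<bar> \<le> R) \<longrightarrow> \<bar>a i z\<bar> \<le> q i" by blast
    have "\<bar>b z\<bar> \<le> 2 * C / \<bar>X 1\<bar>" if "\<forall>j. \<bar>z j\<bar> \<le> R" for z
      using bd[of z 0, OF that] X[of 1] by (simp add: e_0 abs_mult abs_divide field_simps)
    then show "\<forall>z. (\<forall>j. \<bar>z j\<bar> \<le> R) \<longrightarrow> \<bar>b z\<bar> \<le> 2 * C / \<bar>X 1\<bar>" by blast
    show "\<forall>z z' d i. (\<forall>j. \<bar>z j\<bar> \<le> R) \<and> (\<forall>j. \<bar>z' j\<bar> \<le> R) \<and> (\<forall>j. \<bar>z j - z' j\<bar> \<le> d) \<longrightarrow>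
       \<bar>a i z - a i z'\<bar> \<le> d * q i"
    proof (intro allI impI, elim conjE)
      fix z z' :: rinf and d i
      assume z: "\<forall>j. \<bar>z j\<bar> \<le> R" "\<forall>j. \<bar>z' j\<bar> \<le> R" and d: "\<forall>j. \<bar>z j - z' j\<bar> \<le> d"
      have "\<bar>G_fun a b (e z (Suc i)) - G_fun a b (e z' (Suc i))\<bar> \<le> C * d"
      proof (rule C(3)[rule_format], intro conjI allI)
        have "0 \<le> d" using d abs_ge_zero order_trans by blast
        then show "\<bar>e z (Suc i) j - e z' (Suc i) j\<bar> \<le> d" for j using d by (simp add: e_def interleave_def)
      qed (use half z in auto)
      then have "\<bar>a i z - a i z'\<bar> * \<bar>X (2 * i + 3)\<bar> \<le> 2 * (C * d)"
        by (simp add: e_Suc left_diff_distrib[symmetric] abs_mult abs_divide flip: diff_divide_distrib)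
      then show "\<bar>a i z - a i z'\<bar> \<le> d * q i"
        using X[of "2 * i + 3"] by (simp add: q_def field_simps)
    qed
  qed
qed

section \<open>Characteristics and local uniqueness\<close>

text \<open>
  In the direction \<open>(1, - a 0, - a 1, \<dots>)\<close> the Frechet derivative of a solution is exactly the
  differential part of the equation, hence equals \<open>b * u\<close>: the partial differential equation becomes an
  ordinary one along curves with that velocity.
\<close>

lemma cauchy_solution_characteristic_derivative:
  assumes "(U, u) \<in> Xi" "cauchy_solution A a B b W \<phi> U u"
  obtains \<rho> D where "0 < \<rho>" "\<forall>h\<in>ball 0 \<rho>. ell2_nth h \<in> U"
    "\<forall>h\<in>ball 0 \<rho>. ((\<lambda>h. u (ell2_nth h)) has_derivative blinfun_apply (D h)) (at h)"
    "\<forall>h\<in>ball 0 \<rho>. ell2_nth h 0 = 0 \<longrightarrow> u (ell2_nth h) = \<phi> (\<lambda>i. ell2_nth h (Suc i))"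
    "\<forall>h\<in>ball 0 \<rho>. \<forall>y. ell2_nth y 0 = 1 \<and> (\<forall>i. ell2_nth y (Suc i) = - a i (ell2_nth h))
       \<longrightarrow> blinfun_apply (D h) y = b (ell2_nth h) * u (ell2_nth h)"
proof -
  obtain r D where r: "0 < r" and D0: "\<forall>h\<in>ball 0 r. ((\<lambda>h. u (0 + ell2_nth h)) has_derivative blinfun_apply (D h)) (at h)"
    using assms(1) unfolding Xi_def has_frechet_derivative_near_def by blast
  then have D: "\<forall>h\<in>ball 0 r. ((\<lambda>h. u (ell2_nth h)) has_derivative blinfun_apply (D h)) (at h)" by simp
  obtain N where N: "openin T2 N" "0 \<in> N" "N \<subseteq> U"
    and eqs: "\<forall>z\<in>N. (\<forall>j. (\<lambda>s. u (z(j := s))) differentiable at (z j)) \<and>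
       summable (\<lambda>i. a i z * partial_deriv (Suc i) u z) \<and>
       partial_deriv 0 u z - suminf (\<lambda>i. a i z * partial_deriv (Suc i) u z) - b z * u z = 0"
    and inits: "\<forall>x. case_nat 0 x \<in> N \<longrightarrow> x \<in> W \<and> u (case_nat 0 x) = \<phi> x"
    using assms(2) unfolding cauchy_solution_def by (elim exE conjE) (rule that)
  obtain s where s: "s > 0" "ball2 s \<subseteq> N" using openin_T2_contains_ball[OF N(1,2)] by blast
  have inN: "ell2_nth h \<in> N" if "h \<in> ball 0 (min r s)" for h
    using s(2) that by (auto simp: ball2_eq_image_ball)
  show thesis
  proof (rule that[of "min r s" D])
    show "0 < min r s" using r s by simp
    show "\<forall>h\<in>ball 0 (min r s). ell2_nth h \<in> U" using inN N(3) by blast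
    show "\<forall>h\<in>ball 0 (min r s). ((\<lambda>h. u (ell2_nth h)) has_derivative blinfun_apply (D h)) (at h)"
      using D by simp
    show "\<forall>h\<in>ball 0 (min r s). ell2_nth h 0 = 0 \<longrightarrow> u (ell2_nth h) = \<phi> (\<lambda>i. ell2_nth h (Suc i))"
    proof (intro ballI impI)
      fix h assume h: "h \<in> ball 0 (min r s)" "ell2_nth h 0 = 0"
      have "case_nat 0 (\<lambda>i. ell2_nth h (Suc i)) = ell2_nth h"
        using h(2) by (auto simp: fun_eq_iff split: nat.split)
      then show "u (ell2_nth h) = \<phi> (\<lambda>i. ell2_nth h (Suc i))"
        using inits[rule_format, of "\<lambda>i. ell2_nth h (Suc i)"] inN[OF h(1)] by simp
    qed
    show "\<forall>h\<in>ball 0 (min r s). \<forall>y. ell2_nth y 0 = 1 \<and> (\<forall>i. ell2_nth y (Suc i) = - a i (ell2_nth h))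
       \<longrightarrow> blinfun_apply (D h) y = b (ell2_nth h) * u (ell2_nth h)"
    proof (intro ballI allI impI, elim conjE)
      fix h y assume h: "h \<in> ball 0 (min r s)"
        and y: "ell2_nth y 0 = 1" "\<forall>i. ell2_nth y (Suc i) = - a i (ell2_nth h)"
      let ?p = "\<lambda>i. partial_deriv i u (ell2_nth h)"
      have "(\<lambda>i. ell2_nth y i * ?p i) sums (blinfun_apply (D h) y)"
        using D h by (intro has_derivative_as_coordinate_series) auto
      then have "(\<lambda>i. ell2_nth y (Suc i) * ?p (Suc i)) sums (blinfun_apply (D h) y - ?p 0)"
        by (subst sums_Suc_iff) (simp add: y)
      moreover have "(\<lambda>i. ell2_nth y (Suc i) * ?p (Suc i)) sums (- suminf (\<lambda>i. a i (ell2_nth h) * ?p (Suc i)))"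
        using sums_minus[OF summable_sums[OF bspec[OF eqs inN[OF h], THEN conjunct2, THEN conjunct1]]] by (simp add: y(2))
      ultimately have "blinfun_apply (D h) y - ?p 0 = - suminf (\<lambda>i. a i (ell2_nth h) * ?p (Suc i))"
        by (rule sums_unique2)
      then show "blinfun_apply (D h) y = b (ell2_nth h) * u (ell2_nth h)"
        using bspec[OF eqs inN[OF h]] by simp
    qed
  qed
qed

text \<open>
  A point \<open>h0\<close> near the origin, with time coordinate \<open>\<tau>\<close>, is joined to the initial hyperplane by the
  flow line of \<open>- \<tau> *\<^sub>R F\<close> started at \<open>h0\<close>: since \<open>F\<close> advances time at speed 1, the time coordinate
  moves from \<open>\<tau>\<close> to 0 during unit time. Along it \<open>w\<close> satisfies a scalar linear ordinary differential
  equation and ends at 0, so it starts at 0. The factor \<open>\<tau>\<close> is small near the origin, which makes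
  the field slow enough for the flow line to exist inside the ball. Rescaling by \<open>- \<tau>\<close> also treats
  positive and negative times alike.
\<close>

lemma vanishes_along_characteristics:
  fixes w :: "ell2 \<Rightarrow> real" and F :: "ell2 \<Rightarrow> ell2" and D :: "ell2 \<Rightarrow> ell2 \<Rightarrow>\<^sub>L real"
  assumes "0 < R" "1 \<le> M"
    and time: "\<And>h. h \<in> cball 0 R \<Longrightarrow> ell2_nth (F h) 0 = 1"
    and bound: "\<And>h. h \<in> cball 0 R \<Longrightarrow> norm (F h) \<le> M"
    and lip: "\<And>h k. h \<in> cball 0 R \<Longrightarrow> k \<in> cball 0 R \<Longrightarrow> norm (F h - F k) \<le> M * norm (h - k)"
    and deriv: "\<And>h. h \<in> cball 0 R \<Longrightarrow> (w has_derivative blinfun_apply (D h)) (at h)"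
    and eq: "\<And>h. h \<in> cball 0 R \<Longrightarrow> blinfun_apply (D h) (F h) = \<beta> h * w h"
    and \<beta>: "\<And>h. h \<in> cball 0 R \<Longrightarrow> \<bar>\<beta> h\<bar> \<le> K"
    and init: "\<And>h. h \<in> cball 0 R \<Longrightarrow> ell2_nth h 0 = 0 \<Longrightarrow> w h = 0"
  obtains \<delta> where "0 < \<delta>" "\<delta> \<le> R" "\<forall>h\<in>ball 0 \<delta>. w h = 0"
proof -
  \<comment> \<open>Chosen so that a field bounded by \<open>M\<close> with Lipschitz constant \<open>M\<close> satisfies, after scaling by at most \<open>\<delta>\<close>, both requirements for the flow line.\<close>
  define \<delta> where "\<delta> = min R 1 / (2 * M)"
  have "\<delta> * M = min R 1 / 2" using \<open>1 \<le> M\<close> by (simp add: \<delta>_def)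
  then have \<delta>M: "\<delta> * M \<le> R / 2" "\<delta> * M \<le> 1 / 2" by linarith+
  have \<delta>: "0 < \<delta>" using assms(1,2) by (simp add: \<delta>_def)
  then have "\<delta> \<le> \<delta> * M" using \<open>1 \<le> M\<close> by simp
  then have small: "\<delta> \<le> R / 2" "\<delta> \<le> 1" using \<delta>M by linarith+
  show thesis
  proof (rule that[OF \<delta>])
    show "\<delta> \<le> R" using small \<open>0 < R\<close> by linarith
    show "\<forall>h\<in>ball 0 \<delta>. w h = 0"
    proof
      fix h0 :: ell2 assume h0: "h0 \<in> ball 0 \<delta>"
      define \<tau> where "\<tau> = ell2_nth h0 0"
      have \<tau>: "\<bar>\<tau>\<bar> \<le> \<delta>" using abs_ell2_nth_le_norm[of h0 0] h0 by (simp add: \<tau>_def)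
      have \<tau>M: "\<bar>\<tau>\<bar> * M \<le> \<delta> * M" using \<tau> \<open>1 \<le> M\<close> by (intro mult_right_mono) auto
      have K: "0 \<le> K" using \<beta>[of 0] \<open>0 < R\<close> by (auto intro: order_trans[OF abs_ge_zero])
      let ?F = "\<lambda>h. (- \<tau>) *\<^sub>R F h"
      obtain z where z: "continuous_on {0..1::real} z" "z 0 = h0" and z_in_all: "\<forall>t. z t \<in> cball 0 R"
        and z_deriv: "\<forall>t\<in>{0<..<1}. (z has_vector_derivative ?F (z t)) (at t)"
      proof (rule flow_line_exists[of "\<bar>\<tau>\<bar> * M" R ?F h0])
        show "0 \<le> \<bar>\<tau>\<bar> * M" using \<open>1 \<le> M\<close> by simp
        show "\<bar>\<tau>\<bar> * M < 1" using \<tau>M \<delta>M by linarith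
        show "norm (?F x - ?F y) \<le> \<bar>\<tau>\<bar> * M * norm (x - y)" if "x \<in> cball 0 R" "y \<in> cball 0 R" for x y
        proof -
          have "norm (?F x - ?F y) = \<bar>\<tau>\<bar> * norm (F x - F y)"
            by (simp only: scaleR_right_diff_distrib[symmetric] norm_scaleR abs_minus_cancel)
          also have "\<dots> \<le> \<bar>\<tau>\<bar> * (M * norm (x - y))" by (intro mult_left_mono lip that) simp
          finally show ?thesis by (simp add: mult.assoc)
        qed
        show "norm (?F x) \<le> R / 2" if "x \<in> cball 0 R" for x
        proof -
          have "norm (?F x) \<le> \<bar>\<tau>\<bar> * M" using mult_left_mono[OF bound[OF that], of "\<bar>\<tau>\<bar>"] by simp
          then show ?thesis using \<tau>M \<delta>M by linarith
        qed
        show "norm h0 \<le> R / 2" using h0 small by simp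
      qed
      have z_in: "z t \<in> cball 0 R" for t using z_in_all by blast
      have z_flow: "(z has_vector_derivative ?F (z t)) (at t)" if "0 < t" "t < 1" for t
        using z_deriv that by simp
      have "z 1 \<in> cball 0 R" by (rule z_in)
      moreover have "ell2_nth (z 1) 0 = 0"
      proof -
        have "ell2_nth (z 1) 0 + \<tau> * 1 = ell2_nth (z 0) 0 + \<tau> * 0"
        proof (rule DERIV_isconst_end[where f = "\<lambda>t. ell2_nth (z t) 0 + \<tau> * t"])
          show "continuous_on {0..1} (\<lambda>t. ell2_nth (z t) 0 + \<tau> * t)"
            by (intro continuous_intros bounded_linear.continuous_on[OF bounded_linear_ell2_nth] z)
          fix t :: real assume t: "0 < t" "t < 1"
          have "((\<lambda>t. ell2_nth (z t) 0) has_vector_derivative ell2_nth (?F (z t)) 0) (at t)"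
            by (rule bounded_linear.has_vector_derivative[OF bounded_linear_ell2_nth z_flow[OF t]])
          then have "((\<lambda>t. ell2_nth (z t) 0) has_real_derivative - \<tau>) (at t)"
            by (simp add: time[OF z_in] has_real_derivative_iff_has_vector_derivative)
          then show "((\<lambda>t. ell2_nth (z t) 0 + \<tau> * t) has_real_derivative 0) (at t)"
            by (auto intro!: derivative_eq_intros)
        qed simp
        then show ?thesis by (simp add: z(2) \<tau>_def)
      qed
      ultimately have end0: "w (z 1) = 0" by (rule init)
      have contw: "continuous_on (cball 0 R) w"
        by (intro continuous_at_imp_continuous_on ballI has_derivative_continuous[OF deriv])
      have "w (z 0) = 0"
      proof (rule linear_ode_backward_uniqueness[of "\<lambda>t. w (z t)" "\<lambda>t. - \<tau> * \<beta> (z t)" K])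
        show "continuous_on {0..1} (\<lambda>t. w (z t))"
          by (rule continuous_on_compose2[OF contw z(1)]) (use z_in in auto)
        show "w (z 1) = 0" by (rule end0)
        fix t :: real assume t: "0 < t" "t < 1"
        have "((\<lambda>t. w (z t)) has_derivative (\<lambda>s. blinfun_apply (D (z t)) (s *\<^sub>R ?F (z t)))) (at t)"
          using has_derivative_compose[OF z_flow[OF t, unfolded has_vector_derivative_def] deriv[OF z_in]] .
        moreover have "(\<lambda>s. blinfun_apply (D (z t)) (s *\<^sub>R ?F (z t))) = (*) (- \<tau> * \<beta> (z t) * w (z t))"
          by (simp add: fun_eq_iff blinfun.scaleR_right blinfun.minus_right eq[OF z_in])
        ultimately show "((\<lambda>t. w (z t)) has_real_derivative - \<tau> * \<beta> (z t) * w (z t)) (at t)"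
          by (simp only: has_field_derivative_def)
        have "\<bar>\<tau>\<bar> * \<bar>\<beta> (z t)\<bar> \<le> 1 * K" using \<tau> small \<beta>[OF z_in] by (intro mult_mono) auto
        then show "\<bar>- \<tau> * \<beta> (z t)\<bar> \<le> K" by (simp add: abs_mult)
      qed
      then show "w h0 = 0" by (simp add: z(2))
    qed
  qed
qed

text \<open>
  The velocity of the characteristics in the space of pairs of time and position. It takes values in
  \<open>\<ell>\<^sup>2\<close> only where the coefficients are square summable; elsewhere its value is unspecified.
\<close>

definition characteristic_field :: "(nat \<Rightarrow> rinf \<Rightarrow> real) \<Rightarrow> ell2 \<Rightarrow> ell2" where
  "characteristic_field a h = Abs_ell2 (case_nat 1 (\<lambda>i. - a i (ell2_nth h)))"

lemma ell2_nth_characteristic_field: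
  assumes "summable (\<lambda>i. (q i)\<^sup>2)" "\<And>i. \<bar>a i (ell2_nth h)\<bar> \<le> q i"
  shows "ell2_nth (characteristic_field a h) = case_nat 1 (\<lambda>i. - a i (ell2_nth h))"
proof -
  have "summable (\<lambda>i. (a i (ell2_nth h))\<^sup>2)"
  proof (rule summable_comparison_test'[OF assms(1)])
    show "norm ((a i (ell2_nth h))\<^sup>2) \<le> (q i)\<^sup>2" for i
      using power_mono[OF assms(2)[of i] abs_ge_zero, of 2] by simp
  qed
  then have "summable (\<lambda>i. (case_nat 1 (\<lambda>i. - a i (ell2_nth h)) i)\<^sup>2)"
    by (subst summable_Suc_iff[symmetric]) simp
  then show ?thesis by (simp add: characteristic_field_def Abs_ell2_inverse)
qed

theorem theorem4p1:
  fixes A :: "nat \<Rightarrow> rinf set" and a :: "nat \<Rightarrow> rinf \<Rightarrow> real"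
    and B :: "rinf set" and b :: "rinf \<Rightarrow> real"
    and W :: "rinf set" and \<phi> :: "rinf \<Rightarrow> real"
    and U V :: "rinf set" and u v :: "rinf \<Rightarrow> real"
  assumes "\<And>i. analytic_near (A i) (a i) 0"
    and "analytic_near B b 0"
    and "abs_convergent_near_infinity (1 / 2) (G_dom A B a) (G_fun a b) 0"
    and "(W, \<phi>) \<in> Xi"
    and "(U, u) \<in> Xi" and "cauchy_solution A a B b W \<phi> U u"
    and "(V, v) \<in> Xi" and "cauchy_solution A a B b W \<phi> V v"
  shows "\<exists>N. openin T2 N \<and> 0 \<in> N \<and> N \<subseteq> U \<inter> V \<and> (\<forall>z\<in>N. u z = v z)"
proof -
  obtain R0 K q where R0: "0 < R0" and q: "summable (\<lambda>i. (q i)\<^sup>2)"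
    and a_le: "\<forall>z i. (\<forall>j. \<bar>z j\<bar> \<le> R0) \<longrightarrow> \<bar>a i z\<bar> \<le> q i"
    and b_le: "\<forall>z. (\<forall>j. \<bar>z j\<bar> \<le> R0) \<longrightarrow> \<bar>b z\<bar> \<le> K"
    and a_lip: "\<forall>z z' d i. (\<forall>j. \<bar>z j\<bar> \<le> R0) \<and> (\<forall>j. \<bar>z' j\<bar> \<le> R0) \<and> (\<forall>j. \<bar>z j - z' j\<bar> \<le> d) \<longrightarrow>
       \<bar>a i z - a i z'\<bar> \<le> d * q i"
    by (rule cauchy_coefficients_bounds[OF assms(3)])
  obtain ru Du where ru: "0 < ru" "\<forall>h\<in>ball 0 ru. ell2_nth h \<in> U"
    "\<forall>h\<in>ball 0 ru. ((\<lambda>h. u (ell2_nth h)) has_derivative blinfun_apply (Du h)) (at h)"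
    "\<forall>h\<in>ball 0 ru. ell2_nth h 0 = 0 \<longrightarrow> u (ell2_nth h) = \<phi> (\<lambda>i. ell2_nth h (Suc i))"
    "\<forall>h\<in>ball 0 ru. \<forall>y. ell2_nth y 0 = 1 \<and> (\<forall>i. ell2_nth y (Suc i) = - a i (ell2_nth h))
       \<longrightarrow> blinfun_apply (Du h) y = b (ell2_nth h) * u (ell2_nth h)"
    by (rule cauchy_solution_characteristic_derivative[OF assms(5,6)])
  obtain rv Dv where rv: "0 < rv" "\<forall>h\<in>ball 0 rv. ell2_nth h \<in> V"
    "\<forall>h\<in>ball 0 rv. ((\<lambda>h. v (ell2_nth h)) has_derivative blinfun_apply (Dv h)) (at h)"
    "\<forall>h\<in>ball 0 rv. ell2_nth h 0 = 0 \<longrightarrow> v (ell2_nth h) = \<phi> (\<lambda>i. ell2_nth h (Suc i))"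
    "\<forall>h\<in>ball 0 rv. \<forall>y. ell2_nth y 0 = 1 \<and> (\<forall>i. ell2_nth y (Suc i) = - a i (ell2_nth h))
       \<longrightarrow> blinfun_apply (Dv h) y = b (ell2_nth h) * v (ell2_nth h)"
    by (rule cauchy_solution_characteristic_derivative[OF assms(7,8)])
  define R where "R = min R0 (min ru rv / 2)"
  have R: "0 < R" using R0 ru(1) rv(1) by (simp add: R_def)
  have in_balls: "h \<in> ball 0 ru" "h \<in> ball 0 rv" if "h \<in> cball 0 R" for h
    using that ru(1) rv(1) by (auto simp: R_def)
  have small: "\<forall>j. \<bar>ell2_nth h j\<bar> \<le> R0" if "h \<in> cball 0 R" for h
    using that abs_ell2_nth_le_norm[of h] by (auto simp: R_def intro: order_trans)
  define F where "F = characteristic_field a"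
  \<comment> \<open>The entry 1 in front of \<open>q\<close> majorises the time component of the field, so one constant bounds the field and its Lipschitz constant.\<close>
  define Q where "Q = sqrt (suminf (\<lambda>i. (case_nat 1 q i)\<^sup>2))"
  have q1: "summable (\<lambda>i. (case_nat 1 q i)\<^sup>2)"
    by (subst summable_Suc_iff[symmetric]) (simp add: q)
  have F: "ell2_nth (F h) = case_nat 1 (\<lambda>i. - a i (ell2_nth h))" if "h \<in> cball 0 R" for h
    unfolding F_def by (rule ell2_nth_characteristic_field[OF q]) (use a_le small[OF that] in blast)
  have "1 \<le> suminf (\<lambda>i. (case_nat 1 q i)\<^sup>2)"
    using sum_le_suminf[OF q1, of "{0}"] by simp
  then have Q: "1 \<le> Q" by (simp add: Q_def)
  have F_bound: "norm (F h) \<le> Q" if "h \<in> cball 0 R" for h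
  proof -
    have "norm (F h) \<le> 1 * Q"
      unfolding Q_def
    proof (rule norm_ell2_le_majorant[OF q1])
      show "\<bar>ell2_nth (F h) i\<bar> \<le> 1 * case_nat 1 q i" for i
        using a_le small[OF that] by (auto simp: F[OF that] split: nat.split)
    qed simp
    then show ?thesis by simp
  qed
  have F_lip: "norm (F h - F k) \<le> Q * norm (h - k)" if hk: "h \<in> cball 0 R" "k \<in> cball 0 R" for h k
  proof -
    have "norm (F h - F k) \<le> norm (h - k) * Q"
      unfolding Q_def
    proof (rule norm_ell2_le_majorant[OF q1])
      have "\<bar>a i (ell2_nth k) - a i (ell2_nth h)\<bar> \<le> norm (h - k) * q i" for i
        using a_lip[rule_format, of "ell2_nth h" "ell2_nth k" "norm (h - k)" i] small[OF hk(1)] small[OF hk(2)]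
          abs_ell2_nth_le_norm[of "h - k"] by (simp add: abs_minus_commute)
      then show "\<bar>ell2_nth (F h - F k) i\<bar> \<le> norm (h - k) * case_nat 1 q i" for i
        by (auto simp: F[OF hk(1)] F[OF hk(2)] split: nat.split)
    qed simp
    then show ?thesis by (simp add: mult.commute)
  qed
  have deriv_eq: "blinfun_apply (Du h - Dv h) (F h) = b (ell2_nth h) * (u (ell2_nth h) - v (ell2_nth h))"
    if h: "h \<in> cball 0 R" for h
    using ru(5)[rule_format, OF in_balls(1)[OF h], of "F h"] rv(5)[rule_format, OF in_balls(2)[OF h], of "F h"]
    by (simp add: F[OF h] minus_blinfun.rep_eq right_diff_distrib)
  obtain \<delta> where \<delta>: "0 < \<delta>" "\<delta> \<le> R"
    "\<forall>h\<in>ball 0 \<delta>. u (ell2_nth h) - v (ell2_nth h) = 0"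
  proof (rule vanishes_along_characteristics[of R Q F "\<lambda>h. u (ell2_nth h) - v (ell2_nth h)" "\<lambda>h. Du h - Dv h" "\<lambda>h. b (ell2_nth h)" K])
    show "((\<lambda>h. u (ell2_nth h) - v (ell2_nth h)) has_derivative blinfun_apply (Du h - Dv h)) (at h)"
      if "h \<in> cball 0 R" for h
      using has_derivative_diff[OF ru(3)[rule_format, OF in_balls(1)[OF that]] rv(3)[rule_format, OF in_balls(2)[OF that]]]
      by (simp add: minus_blinfun.rep_eq[abs_def] fun_diff_def)
    show "u (ell2_nth h) - v (ell2_nth h) = 0" if "h \<in> cball 0 R" "ell2_nth h 0 = 0" for h
      using ru(4) rv(4) in_balls[OF that(1)] that(2) by simp
  qed (use R Q F F_bound F_lip deriv_eq b_le small in auto)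
  show ?thesis
  proof (intro exI[of _ "ball2 \<delta>"] conjI ballI)
    have "ball2 \<delta> = (+) 0 ` ball2 \<delta>" by simp
    then show "openin T2 (ball2 \<delta>)"
      unfolding T2_def using \<delta>(1) by (intro topology_generated_by_Basis) blast
    show "0 \<in> ball2 \<delta>" using \<delta>(1) by (simp add: ball2_def)
    show "ball2 \<delta> \<subseteq> U \<inter> V"
      unfolding ball2_eq_image_ball
    proof (intro image_subsetI IntI)
      fix h :: ell2 assume "h \<in> ball 0 \<delta>"
      then have "h \<in> cball 0 R" using \<delta>(2) by simp
      then show "ell2_nth h \<in> U" "ell2_nth h \<in> V" using ru(2) rv(2) in_balls by blast+
    qed
    show "u z = v z" if "z \<in> ball2 \<delta>" for z
      using \<delta>(3) that unfolding ball2_eq_image_ball by auto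
  qed
qed

end
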